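(* Let $n\ge1$, let $(\tilde\Omega,\tilde d)$ be a metric space, and let $\Psi^n_{\tilde\Omega}$ be the set of all maps $\psi:[n]\to\tilde\Omega$. For $\psi_A,\psi_B\in\Psi^n_{\tilde\Omega}$ let $D_{\psi_A,\psi_B}\in\mathbb{R}^{n\times n}$ have $(u,v)$ entry $\tilde d(\psi_A(u),\psi_B(v))$. Let $\mathbb{W}^n$ be the set of $n\times n$ doubly stochastic matrices, and for a matrix norm $\|\cdot\|$ on $\mathbb{R}^{n\times n}$ define, for $(A,\psi_A),(B,\psi_B)\in\mathbb{R}^{n\times n}\times\Psi^n_{\tilde\Omega}$, $$d_{\mathbb{W}^n}\big((A,\psi_A),(B,\psi_B)\big)=\min_{W\in\mathbb{W}^n}\Big[\|AW-WB\|+\mathrm{tr}\big(W^\top D_{\psi_A,\psi_B}\big)\Big].$$ (i) If $\|\cdot\|$ is an arbitrary entry-wise $p$-norm, then $d_{\mathbb{W}^n}$ is a pseudometric on $\mathbb{S}^n\times\Psi^n_{\tilde\Omega}$, where $\mathbb{S}^n$ is the set of real symmetric $n\times n$ matrices. (ii) If $\|\cdot\|$ is an arbitrary entry-wise $p$-norm or operator $p$-norm, then the symmetric extension $\bar d_{\mathbb{W}^n}(x,y)=d_{\mathbb{W}^n}(x,y)+d_{\mathbb{W}^n}(y,x)$ is a pseudometric on $\mathbb{R}^{n\times n}\times\Psi^n_{\tilde\Omega}$.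
   Context: $[n]=\{1,\dots,n\}$. Doubly stochastic: $W\in[0,1]^{n\times n}$ with $W\mathbf{1}=\mathbf{1}$ and $W^\top\mathbf{1}=\mathbf{1}$. For $p\in\{1,2,\dots\}\cup\{\infty\}$, the entry-wise $p$-norm of $A=[a_{ij}]$ is $(\sum_{i,j}|a_{ij}|^p)^{1/p}$ ($\max|a_{ij}|$ if $p=\infty$); the operator $p$-norm is $\sup_{\|x\|_p=1}\|Ax\|_p$. A pseudometric on $\Omega$ is $d:\Omega\times\Omega\to\mathbb{R}$ with, for all $x,y,z$: $d(x,y)\ge0$, $d(x,x)=0$, $d(x,y)=d(y,x)$, $d(x,y)\le d(x,z)+d(z,y)$. *)

theory Defs
  imports "HOL-Analysis.Analysis" "HOL-Library.Extended_Nat"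
begin

definition pseudometric_on :: "'a set \<Rightarrow> ('a \<Rightarrow> 'a \<Rightarrow> real) \<Rightarrow> bool" where
  "pseudometric_on S d \<longleftrightarrow>
     (\<forall>x\<in>S. \<forall>y\<in>S. 0 \<le> d x y) \<and>
     (\<forall>x\<in>S. d x x = 0) \<and>
     (\<forall>x\<in>S. \<forall>y\<in>S. d x y = d y x) \<and>
     (\<forall>x\<in>S. \<forall>y\<in>S. \<forall>z\<in>S. d x y \<le> d x z + d z y)"

definition doubly_stochastic :: "(real^'n^'n) set" where
  "doubly_stochastic =
     {W. (\<forall>i j. 0 \<le> W $ i $ j \<and> W $ i $ j \<le> 1) \<and>
         W *v vec 1 = vec 1 \<and> transpose W *v vec 1 = vec 1}"

definition symmetric_matrices :: "(real^'n^'n) set" where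
  "symmetric_matrices = {A. transpose A = A}"

text \<open>The exponent of the norms below ranges over the extended naturals and is meant to be at
  least 1; \<open>root k\<close> is the \<open>1/k\<close>-th power on nonnegative reals.\<close>

definition vec_pnorm :: "enat \<Rightarrow> real^'n \<Rightarrow> real" where
  "vec_pnorm p x =
     (case p of enat k \<Rightarrow> root k (\<Sum>i\<in>UNIV. \<bar>x $ i\<bar> ^ k)
              | \<infinity> \<Rightarrow> Max (range (\<lambda>i. \<bar>x $ i\<bar>)))"

definition entrywise_pnorm :: "enat \<Rightarrow> real^'n^'n \<Rightarrow> real" where
  "entrywise_pnorm p A =
     (case p of enat k \<Rightarrow> root k (\<Sum>i\<in>UNIV. \<Sum>j\<in>UNIV. \<bar>A $ i $ j\<bar> ^ k)
              | \<infinity> \<Rightarrow> Max (range (\<lambda>(i, j). \<bar>A $ i $ j\<bar>)))"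

definition operator_pnorm :: "enat \<Rightarrow> real^'n^'n \<Rightarrow> real" where
  "operator_pnorm p A = (SUP x\<in>{x. vec_pnorm p x = 1}. vec_pnorm p (A *v x))"

definition embeddings :: "'a set \<Rightarrow> ('n::finite \<Rightarrow> 'a) set" where
  "embeddings \<Omega> = UNIV \<rightarrow> \<Omega>"

definition cross_dist :: "('a \<Rightarrow> 'a \<Rightarrow> real) \<Rightarrow> ('n::finite \<Rightarrow> 'a) \<Rightarrow> ('n \<Rightarrow> 'a) \<Rightarrow> real^'n^'n" where
  "cross_dist d \<psi>A \<psi>B = (\<chi> u v. d (\<psi>A u) (\<psi>B v))"

text \<open>A genuine minimum rather than an infimum: \<open>LEAST\<close> is unspecified unless the set of
  objective values has a least element.\<close>

definition dist_W ::
  "(real^'n^'n \<Rightarrow> real) \<Rightarrow> ('a \<Rightarrow> 'a \<Rightarrow> real) \<Rightarrow>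
     (real^'n^'n) \<times> ('n \<Rightarrow> 'a) \<Rightarrow> (real^'n^'n) \<times> ('n \<Rightarrow> 'a) \<Rightarrow> real" where
  "dist_W N d = (\<lambda>(A, \<psi>A) (B, \<psi>B).
     LEAST r. \<exists>W\<in>doubly_stochastic.
       r = N (A ** W - W ** B) + trace (transpose W ** cross_dist d \<psi>A \<psi>B))"

definition symmetric_ext :: "('a \<Rightarrow> 'a \<Rightarrow> real) \<Rightarrow> 'a \<Rightarrow> 'a \<Rightarrow> real" where
  "symmetric_ext d x y = d x y + d y x"

end

theory Submission
  imports Defs
begin

text \<open>
  Jensen's inequality for \<open>t \<mapsto> t\<^sup>p\<close> shows that a doubly stochastic matrix does not increase the
  p-norm of a vector. Hence multiplication by a doubly stochastic matrix on either side does not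
  increase the operator p-norm, nor the entry-wise p-norm, which is the p-norm of a vector indexed
  by pairs. The minimum is attained because the doubly stochastic matrices form a compact set. If
  \<open>V\<close> and \<open>W\<close> are optimal for \<open>(A, C)\<close> and \<open>(C, B)\<close>, the triangle inequality follows by testing
  with \<open>V W\<close>, since \<open>A V W - V W B = (A V - V C) W + V (C W - W B)\<close>. For symmetric \<open>A\<close> and \<open>B\<close>,
  transposing \<open>W\<close> exchanges the two arguments.
\<close>

section \<open>Doubly stochastic matrices\<close>

text \<open>An entry is one term of a row sum of nonnegative terms with value 1, so nonnegativity
  and the sums already give the upper bound 1.\<close>

lemma doubly_stochastic_iff:
  "W \<in> doubly_stochastic \<longleftrightarrow>
     (\<forall>i j. 0 \<le> W $ i $ j) \<and> (\<forall>i. (\<Sum>j\<in>UNIV. W $ i $ j) = 1) \<and> (\<forall>j. (\<Sum>i\<in>UNIV. W $ i $ j) = 1)"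
  (is "_ \<longleftrightarrow> ?R")
proof
  assume ?R
  have "W $ i $ j \<le> 1" for i j
    using member_le_sum[of j UNIV "\<lambda>j. W $ i $ j"] \<open>?R\<close> by simp
  with \<open>?R\<close> show "W \<in> doubly_stochastic"
    by (simp add: doubly_stochastic_def vec_eq_iff matrix_vector_mult_def transpose_def)
qed (simp add: doubly_stochastic_def vec_eq_iff matrix_vector_mult_def transpose_def)

lemma doubly_stochasticD:
  assumes "W \<in> doubly_stochastic"
  shows "0 \<le> W $ i $ j" "(\<Sum>j\<in>UNIV. W $ i $ j) = 1" "(\<Sum>i\<in>UNIV. W $ i $ j) = 1"
  using assms by (auto simp: doubly_stochastic_iff)

lemma doubly_stochastic_transpose:
  "W \<in> doubly_stochastic \<Longrightarrow> transpose W \<in> doubly_stochastic"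
  by (auto simp: doubly_stochastic_iff transpose_def)

lemma doubly_stochastic_mat_1: "mat 1 \<in> doubly_stochastic"
  by (simp add: doubly_stochastic_iff mat_def)

lemma doubly_stochastic_mult:
  assumes "V \<in> doubly_stochastic" "W \<in> doubly_stochastic"
  shows "V ** W \<in> doubly_stochastic"
proof -
  note V = doubly_stochasticD[OF assms(1)] and W = doubly_stochasticD[OF assms(2)]
  have "(\<Sum>j\<in>UNIV. \<Sum>k\<in>UNIV. V $ i $ k * W $ k $ j) = 1" for i
    by (subst sum.swap) (simp add: sum_distrib_left[symmetric] V W)
  moreover have "(\<Sum>i\<in>UNIV. \<Sum>k\<in>UNIV. V $ i $ k * W $ k $ j) = 1" for j
    by (subst sum.swap) (simp add: sum_distrib_right[symmetric] V W)
  ultimately show ?thesis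
    by (simp add: doubly_stochastic_iff matrix_matrix_mult_def sum_nonneg V W)
qed

text \<open>Heine-Borel: the set is cut out by weak inequalities and equations between continuous
  functions, and every row has l1-norm 1, so \<open>CARD('n)\<close> bounds the norm.\<close>

lemma compact_doubly_stochastic: "compact (doubly_stochastic :: (real^'n^'n) set)"
proof -
  have "doubly_stochastic = {W :: real^'n^'n. (\<forall>i j. 0 \<le> W $ i $ j) \<and>
      (\<forall>i. (\<Sum>j\<in>UNIV. W $ i $ j) = 1) \<and> (\<forall>j. (\<Sum>i\<in>UNIV. W $ i $ j) = 1)}"
    by (auto simp: doubly_stochastic_iff)
  also have "closed \<dots>"
    by (intro closed_Collect_conj closed_Collect_all closed_Collect_le closed_Collect_eq continuous_intros)
  finally have "closed (doubly_stochastic :: (real^'n^'n) set)" .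
  moreover have "bounded (doubly_stochastic :: (real^'n^'n) set)"
  proof (rule boundedI)
    fix W :: "real^'n^'n" assume W: "W \<in> doubly_stochastic"
    have "norm W \<le> (\<Sum>i\<in>UNIV. norm (W $ i))"
      unfolding norm_vec_def by (intro L2_set_le_sum) simp
    also have "\<dots> \<le> (\<Sum>i\<in>(UNIV :: 'n set). 1)"
    proof (rule sum_mono)
      fix i
      have "norm (W $ i) \<le> (\<Sum>j\<in>UNIV. \<bar>W $ i $ j\<bar>)"
        by (rule norm_le_l1_cart)
      then show "norm (W $ i) \<le> 1"
        using doubly_stochasticD[OF W] by simp
    qed
    finally show "norm W \<le> CARD('n)" by simp
  qed
  ultimately show ?thesis
    by (simp add: compact_eq_bounded_closed)
qed

section \<open>Vector p-norms\<close>

text \<open>Jensen's inequality, after the triangle inequality has moved the absolute value inside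
  the sum. It yields both Minkowski's inequality and the contraction property; the exponent 1 serves
  the maximum norm.\<close>

lemma convex_combination_power_le:
  fixes a y :: "'i \<Rightarrow> real"
  assumes "finite S" "\<And>i. i \<in> S \<Longrightarrow> 0 \<le> a i" "sum a S = 1"
  shows "\<bar>\<Sum>i\<in>S. a i * y i\<bar> ^ k \<le> (\<Sum>i\<in>S. a i * \<bar>y i\<bar> ^ k)"
proof -
  \<comment> \<open>Odd powers are convex only on the nonnegative half-line, where the values
    \<open>\<bar>y i\<bar>\<close> lie.\<close>
  have "convex_on {0::real..} (\<lambda>x. x ^ k)"
    by (cases "even k")
       (auto intro: convex_power_odd convex_on_subset[OF convex_power_even])
  have "\<bar>\<Sum>i\<in>S. a i * y i\<bar> \<le> (\<Sum>i\<in>S. a i * \<bar>y i\<bar>)"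
    using sum_abs[of "\<lambda>i. a i * y i" S] assms(2) by (simp add: abs_mult)
  then have "\<bar>\<Sum>i\<in>S. a i * y i\<bar> ^ k \<le> (\<Sum>i\<in>S. a i * \<bar>y i\<bar>) ^ k"
    by (rule power_mono) simp
  also have "\<dots> \<le> (\<Sum>i\<in>S. a i * \<bar>y i\<bar> ^ k)"
  proof -
    have "S \<noteq> {}" using assms(3) by auto
    from convex_on_sum[OF assms(1) this \<open>convex_on {0..} _\<close> assms(3), of "\<lambda>i. \<bar>y i\<bar>"] assms(2)
    show ?thesis by simp
  qed
  finally show ?thesis .
qed

lemma enat_ge_1_cases:
  assumes "1 \<le> p"
  obtains k where "p = enat k" "0 < k" | "p = \<infinity>"
  using assms by (cases p) (auto simp: one_enat_def)

lemma vec_pnorm_enat_power: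
  assumes "0 < k"
  shows "vec_pnorm (enat k) x ^ k = (\<Sum>i\<in>UNIV. \<bar>x $ i\<bar> ^ k)"
  using assms by (simp add: vec_pnorm_def sum_nonneg)

lemma vec_pnorm_infinity_le_iff:
  "vec_pnorm \<infinity> x \<le> c \<longleftrightarrow> (\<forall>i. \<bar>x $ i\<bar> \<le> c)"
  by (auto simp: vec_pnorm_def)

text \<open>For finite \<open>p\<close>, \<open>\<bar>x $ i\<bar> ^ k\<close> is one term of the sum
  under the root. Nonnegativity, definiteness and the finiteness of the operator norm rest on this
  bound.\<close>

lemma abs_component_le_vec_pnorm:
  assumes "1 \<le> p"
  shows "\<bar>x $ i\<bar> \<le> vec_pnorm p x"
  using assms
proof (cases rule: enat_ge_1_cases)
  case (1 k)
  have "\<bar>x $ i\<bar> ^ k \<le> (\<Sum>i\<in>UNIV. \<bar>x $ i\<bar> ^ k)"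
    by (rule member_le_sum) auto
  with 1 have "root k (\<bar>x $ i\<bar> ^ k) \<le> vec_pnorm p x"
    by (simp add: vec_pnorm_def)
  with 1 show ?thesis by (simp add: real_root_power_cancel)
qed (simp add: vec_pnorm_def)

lemma vec_pnorm_nonneg: "1 \<le> p \<Longrightarrow> 0 \<le> vec_pnorm p x"
  using abs_component_le_vec_pnorm[of p x] abs_ge_zero order_trans by blast

lemma vec_pnorm_eq_0_iff:
  assumes "1 \<le> p"
  shows "vec_pnorm p x = 0 \<longleftrightarrow> x = 0"
proof
  assume "vec_pnorm p x = 0"
  then have "\<bar>x $ i\<bar> \<le> 0" for i
    using abs_component_le_vec_pnorm[OF assms, of x i] by simp
  then show "x = 0" by (simp add: vec_eq_iff)
next
  assume "x = 0"
  with assms show "vec_pnorm p x = 0"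
    by (cases rule: enat_ge_1_cases) (simp_all add: vec_pnorm_def power_0_left)
qed

lemma vec_pnorm_zero: "1 \<le> p \<Longrightarrow> vec_pnorm p 0 = 0"
  by (simp add: vec_pnorm_eq_0_iff)

lemma vec_pnorm_enat_leI:
  assumes "0 < k" "0 \<le> c" "(\<Sum>i\<in>UNIV. \<bar>x $ i\<bar> ^ k) \<le> c ^ k"
  shows "vec_pnorm (enat k) x \<le> c"
proof -
  have "vec_pnorm (enat k) x ^ k \<le> c ^ k"
    using assms by (simp add: vec_pnorm_enat_power)
  then show ?thesis using assms power_mono_iff[of "vec_pnorm (enat k) x" c k]
    vec_pnorm_nonneg[of "enat k" x] by (simp add: one_enat_def)
qed

lemma vec_pnorm_scaleR_le:
  assumes "1 \<le> p"
  shows "vec_pnorm p (c *\<^sub>R x) \<le> \<bar>c\<bar> * vec_pnorm p x"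
  using assms
proof (cases rule: enat_ge_1_cases)
  case (1 k)
  show ?thesis unfolding 1(1)
    using 1 vec_pnorm_nonneg[OF assms, of x]
    by (intro vec_pnorm_enat_leI)
       (auto simp: power_mult_distrib vec_pnorm_enat_power abs_mult sum_distrib_left)
next
  case 2
  then show ?thesis using abs_component_le_vec_pnorm[OF assms, of x]
    by (auto simp: vec_pnorm_infinity_le_iff abs_mult intro: mult_left_mono)
qed

text \<open>The reverse inequality is the previous bound applied to the factor
  \<open>inverse c\<close> and the vector \<open>c *\<^sub>R x\<close>.\<close>

lemma vec_pnorm_scaleR:
  assumes "1 \<le> p"
  shows "vec_pnorm p (c *\<^sub>R x) = \<bar>c\<bar> * vec_pnorm p x"
proof (cases "c = 0")
  case True
  then show ?thesis by (simp add: vec_pnorm_zero[OF assms])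
next
  case False
  have "vec_pnorm p x \<le> \<bar>inverse c\<bar> * vec_pnorm p (c *\<^sub>R x)"
    using vec_pnorm_scaleR_le[OF assms, of "inverse c" "c *\<^sub>R x"] False by simp
  with False have "\<bar>c\<bar> * vec_pnorm p x \<le> vec_pnorm p (c *\<^sub>R x)"
    by (simp add: field_simps)
  with vec_pnorm_scaleR_le[OF assms, of c x] show ?thesis by simp
qed

text \<open>Minkowski's inequality, derived from the convexity of the \<open>k\<close>-th power
  rather than from Hoelder's inequality.\<close>

lemma vec_pnorm_add_le:
  assumes "1 \<le> p"
  shows "vec_pnorm p (x + y) \<le> vec_pnorm p x + vec_pnorm p y"
  using assms
proof (cases rule: enat_ge_1_cases)
  case (1 k)
  define a b where "a = vec_pnorm p x" and "b = vec_pnorm p y"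
  show ?thesis
  proof (cases "x = 0 \<or> y = 0")
    case True
    then show ?thesis by (auto simp: vec_pnorm_nonneg assms)
  next
    case False
    then have "a > 0" "b > 0"
      using vec_pnorm_nonneg[OF assms] vec_pnorm_eq_0_iff[OF assms]
      by (auto simp: a_def b_def less_le)
    have S: "(\<Sum>i\<in>UNIV. \<bar>x $ i\<bar> ^ k) = a ^ k" "(\<Sum>i\<in>UNIV. \<bar>y $ i\<bar> ^ k) = b ^ k"
      using 1 by (simp_all add: a_def b_def vec_pnorm_enat_power)
    \<comment> \<open>\<open>(x + y) / (a + b)\<close> is a convex combination of the unit vectors \<open>x / a\<close> and \<open>y / b\<close>.\<close>
    have "\<bar>x $ i + y $ i\<bar> ^ k \<le> (a + b) ^ k *
            (a / (a + b) * (\<bar>x $ i\<bar> ^ k / a ^ k) + b / (a + b) * (\<bar>y $ i\<bar> ^ k / b ^ k))" for i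
    proof -
      \<comment> \<open>A convex combination of two points is written as a sum over
        \<open>bool\<close>, so that Jensen's inequality for finite sums applies.\<close>
      have "\<bar>\<Sum>s\<in>UNIV. (if s then a / (a + b) else b / (a + b)) * (if s then x $ i / a else y $ i / b)\<bar> ^ k
          \<le> (\<Sum>s\<in>UNIV. (if s then a / (a + b) else b / (a + b)) * \<bar>if s then x $ i / a else y $ i / b\<bar> ^ k)"
        using \<open>a > 0\<close> \<open>b > 0\<close>
        by (intro convex_combination_power_le) (auto simp: UNIV_bool add_divide_distrib[symmetric])
      then have *: "\<bar>x $ i / (a + b) + y $ i / (a + b)\<bar> ^ k
          \<le> a / (a + b) * (\<bar>x $ i\<bar> ^ k / a ^ k) + b / (a + b) * (\<bar>y $ i\<bar> ^ k / b ^ k)"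
        using \<open>a > 0\<close> \<open>b > 0\<close> by (simp add: UNIV_bool power_divide add.commute)
      have "\<bar>x $ i + y $ i\<bar> ^ k = (a + b) ^ k * \<bar>x $ i / (a + b) + y $ i / (a + b)\<bar> ^ k"
        using \<open>a > 0\<close> \<open>b > 0\<close> by (simp add: add_divide_distrib[symmetric] power_divide)
      also have "\<dots> \<le> (a + b) ^ k *
            (a / (a + b) * (\<bar>x $ i\<bar> ^ k / a ^ k) + b / (a + b) * (\<bar>y $ i\<bar> ^ k / b ^ k))"
        using \<open>a > 0\<close> \<open>b > 0\<close> by (intro mult_left_mono *) simp
      finally show ?thesis .
    qed
    then have "(\<Sum>i\<in>UNIV. \<bar>(x + y) $ i\<bar> ^ k) \<le> (\<Sum>i\<in>UNIV. (a + b) ^ k *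
            (a / (a + b) * (\<bar>x $ i\<bar> ^ k / a ^ k) + b / (a + b) * (\<bar>y $ i\<bar> ^ k / b ^ k)))"
      by (intro sum_mono) simp
    \<comment> \<open>Summed over \<open>i\<close>, the normalised powers give 1 for
      \<open>x\<close> and for \<open>y\<close>; the weights that remain add up to 1.\<close>
    also have "\<dots> = (a + b) ^ k * (a / (a + b) * (a ^ k / a ^ k) + b / (a + b) * (b ^ k / b ^ k))"
      by (simp add: sum_distrib_left[symmetric] sum.distrib sum_divide_distrib[symmetric] S)
    also have "\<dots> = (a + b) ^ k"
      using \<open>a > 0\<close> \<open>b > 0\<close> by (simp add: add_divide_distrib[symmetric])
    finally have "vec_pnorm p (x + y) \<le> a + b"
      using 1 \<open>a > 0\<close> \<open>b > 0\<close> by (simp add: vec_pnorm_enat_leI)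
    then show ?thesis by (simp only: a_def b_def)
  qed
next
  case 2
  then show ?thesis
    using abs_component_le_vec_pnorm[OF assms, of x] abs_component_le_vec_pnorm[OF assms, of y]
    by (auto simp: vec_pnorm_infinity_le_iff intro: order_trans[OF abs_triangle_ineq add_mono])
qed

lemma vec_pnorm_sum_le:
  assumes "1 \<le> p"
  shows "vec_pnorm p (sum f S) \<le> (\<Sum>i\<in>S. vec_pnorm p (f i))"
proof (induction S rule: infinite_finite_induct)
  case (insert i S)
  then show ?case using vec_pnorm_add_le[OF assms, of "f i" "sum f S"] by simp
qed (simp_all add: vec_pnorm_zero assms)

text \<open>For finite \<open>p\<close>, the row sums make each entry of \<open>W *v x\<close> an
  average, to which Jensen applies; exchanging the sums then brings in the column sums. For the
  maximum norm, an average of entries is bounded by the largest one.\<close>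

lemma vec_pnorm_doubly_stochastic_le:
  assumes "1 \<le> p" "W \<in> doubly_stochastic"
  shows "vec_pnorm p (W *v x) \<le> vec_pnorm p x"
  using assms(1)
proof (cases rule: enat_ge_1_cases)
  case (1 k)
  have "(\<Sum>i\<in>UNIV. \<bar>(W *v x) $ i\<bar> ^ k) \<le> (\<Sum>i\<in>UNIV. \<Sum>j\<in>UNIV. W $ i $ j * \<bar>x $ j\<bar> ^ k)"
    unfolding matrix_vector_mult_def
    by (simp, intro sum_mono convex_combination_power_le)
       (simp_all add: doubly_stochasticD[OF assms(2)])
  also have "\<dots> = (\<Sum>j\<in>UNIV. \<bar>x $ j\<bar> ^ k)"
    by (subst sum.swap)
       (simp add: sum_distrib_right[symmetric] doubly_stochasticD[OF assms(2)])
  finally show ?thesis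
    using 1 vec_pnorm_nonneg[OF assms(1)] by (auto intro!: vec_pnorm_enat_leI simp: vec_pnorm_enat_power)
next
  case 2
  have "\<bar>(W *v x) $ i\<bar> \<le> vec_pnorm p x" for i
  proof -
    have "\<bar>(W *v x) $ i\<bar> \<le> (\<Sum>j\<in>UNIV. W $ i $ j * \<bar>x $ j\<bar>)"
      using convex_combination_power_le[of UNIV "\<lambda>j. W $ i $ j" "\<lambda>j. x $ j" 1]
      by (simp add: matrix_vector_mult_def doubly_stochasticD[OF assms(2)])
    also have "\<dots> \<le> (\<Sum>j\<in>UNIV. W $ i $ j * vec_pnorm p x)"
      by (intro sum_mono mult_left_mono abs_component_le_vec_pnorm doubly_stochasticD assms)
    finally show ?thesis
      by (simp add: sum_distrib_right[symmetric] doubly_stochasticD[OF assms(2)])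
  qed
  with 2 show ?thesis by (simp add: vec_pnorm_infinity_le_iff)
qed

section \<open>Seminorms contracted by doubly stochastic matrices\<close>

text \<open>The properties that attainment of the minimum and the triangle inequality take from the
  norm, so that both families of norms are treated at once. Invariance under transposition is kept
  apart and enters only for symmetric matrices.\<close>

locale stochastic_seminorm =
  fixes N :: "real^'n^'n \<Rightarrow> real"
  assumes add_le: "N (A + B) \<le> N A + N B"
    and scaleR_le: "N (c *\<^sub>R A) \<le> \<bar>c\<bar> * N A"
    and left_contraction: "W \<in> doubly_stochastic \<Longrightarrow> N (W ** A) \<le> N A"
    and right_contraction: "W \<in> doubly_stochastic \<Longrightarrow> N (A ** W) \<le> N A"

subsection \<open>Entry-wise norms\<close>

definition flatten :: "real^'n^'n \<Rightarrow> real^('n \<times> 'n)" where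
  "flatten A = (\<chi> ij. A $ fst ij $ snd ij)"

lemma entrywise_pnorm_eq_vec_pnorm: "entrywise_pnorm p A = vec_pnorm p (flatten A)"
proof (cases p)
  case (enat k)
  then show ?thesis
    by (simp add: entrywise_pnorm_def vec_pnorm_def flatten_def sum.cartesian_product case_prod_beta)
qed (simp add: entrywise_pnorm_def vec_pnorm_def flatten_def case_prod_beta)

lemma entrywise_pnorm_transpose: "entrywise_pnorm p (transpose A) = entrywise_pnorm p A"
proof (cases p)
  case (enat k)
  then show ?thesis
    by (simp add: entrywise_pnorm_def transpose_def) (subst sum.swap, simp)
next
  case infinity
  have "range (\<lambda>(i, j). \<bar>transpose A $ i $ j\<bar>) = range (\<lambda>(i, j). \<bar>A $ i $ j\<bar>)"
    by (auto simp: transpose_def image_iff)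
  with infinity show ?thesis by (simp add: entrywise_pnorm_def)
qed

text \<open>The first coordinate is summed innermost, where the Kronecker delta in the matrix
  \<open>K\<close> below collapses the sum.\<close>

lemma sum_UNIV_prod:
  fixes f :: "'i::finite \<times> 'j::finite \<Rightarrow> 'c::comm_monoid_add"
  shows "sum f UNIV = (\<Sum>j\<in>UNIV. \<Sum>i\<in>UNIV. f (i, j))"
  by (subst sum.swap) (simp add: sum.cartesian_product)

text \<open>Right multiplication by \<open>W\<close> acts on the flattened matrix as a doubly
  stochastic matrix indexed by pairs, whose row sums are column sums of \<open>W\<close> and vice
  versa. The contraction of the vector norm then applies.\<close>

lemma entrywise_pnorm_mult_right_le:
  fixes A W :: "real^'n^'n"
  assumes "1 \<le> p" and W: "W \<in> doubly_stochastic"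
  shows "entrywise_pnorm p (A ** W) \<le> entrywise_pnorm p A"
proof -
  \<comment> \<open>The Kronecker product of the identity and the transpose of \<open>W\<close>.\<close>
  define K :: "real^('n \<times> 'n)^('n \<times> 'n)"
    where "K = (\<chi> ij kl. if fst ij = fst kl then W $ snd kl $ snd ij else 0)"
  have "K \<in> doubly_stochastic"
    by (simp add: doubly_stochastic_iff K_def sum_UNIV_prod doubly_stochasticD[OF W])
  moreover have "flatten (A ** W) = K *v flatten A"
    by (simp add: vec_eq_iff flatten_def K_def matrix_vector_mult_def matrix_matrix_mult_def
        sum_UNIV_prod if_distrib[of "(*) x" for x] mult.commute cong: if_cong)
  ultimately show ?thesis
    by (simp add: entrywise_pnorm_eq_vec_pnorm vec_pnorm_doubly_stochastic_le[OF assms(1)])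
qed

lemma stochastic_seminorm_entrywise_pnorm:
  assumes "1 \<le> p"
  shows "stochastic_seminorm (entrywise_pnorm p)"
proof
  fix A B W :: "real^'n^'n" and c :: real
  have "flatten (A + B) = flatten A + flatten B" "flatten (c *\<^sub>R A) = c *\<^sub>R flatten A"
    by (simp_all add: flatten_def vec_eq_iff)
  then show "entrywise_pnorm p (A + B) \<le> entrywise_pnorm p A + entrywise_pnorm p B"
    and "entrywise_pnorm p (c *\<^sub>R A) \<le> \<bar>c\<bar> * entrywise_pnorm p A"
    by (simp_all add: entrywise_pnorm_eq_vec_pnorm vec_pnorm_add_le vec_pnorm_scaleR_le assms)
  assume W: "W \<in> doubly_stochastic"
  show "entrywise_pnorm p (A ** W) \<le> entrywise_pnorm p A"
    by (rule entrywise_pnorm_mult_right_le[OF assms W])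
  \<comment> \<open>Transposition turns left multiplication by \<open>W\<close> into right
    multiplication by \<open>transpose W\<close>.\<close>
  show "entrywise_pnorm p (W ** A) \<le> entrywise_pnorm p A"
    using entrywise_pnorm_mult_right_le[OF assms doubly_stochastic_transpose[OF W], of "transpose A"]
    by (simp add: entrywise_pnorm_transpose flip: matrix_transpose_mul)
qed

subsection \<open>Operator norms\<close>

text \<open>A real \<open>SUP\<close> is informative only over a set bounded above. Here
  \<open>A *v x\<close> combines the columns of \<open>A\<close> with coefficients of absolute value
  at most 1.\<close>

lemma bdd_above_operator_pnorm:
  fixes A :: "real^'n^'n"
  assumes "1 \<le> p"
  shows "bdd_above ((\<lambda>x. vec_pnorm p (A *v x)) ` {x. vec_pnorm p x = 1})"
proof (rule bdd_aboveI2)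
  fix x :: "real^'n" assume x: "x \<in> {x. vec_pnorm p x = 1}"
  have "vec_pnorm p (A *v x) \<le> (\<Sum>i\<in>UNIV. vec_pnorm p (x $ i *\<^sub>R column i A))"
    unfolding matrix_mult_sum scalar_mult_eq_scaleR by (rule vec_pnorm_sum_le[OF assms])
  also have "\<dots> \<le> (\<Sum>i\<in>UNIV. 1 * vec_pnorm p (column i A))"
    unfolding vec_pnorm_scaleR[OF assms]
    using x abs_component_le_vec_pnorm[OF assms, of x]
    by (intro sum_mono mult_right_mono vec_pnorm_nonneg assms) simp
  finally show "vec_pnorm p (A *v x) \<le> (\<Sum>i\<in>UNIV. 1 * vec_pnorm p (column i A))" .
qed

lemma vec_pnorm_le_operator_pnorm:
  assumes "1 \<le> p"
  shows "vec_pnorm p (A *v x) \<le> operator_pnorm p A * vec_pnorm p x"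
proof (cases "x = 0")
  case True
  then show ?thesis by (simp add: vec_pnorm_zero[OF assms])
next
  case False
  define c where "c = vec_pnorm p x"
  have "c > 0"
    using False vec_pnorm_nonneg[OF assms, of x] vec_pnorm_eq_0_iff[OF assms, of x]
    by (simp add: c_def)
  then have "vec_pnorm p (inverse c *\<^sub>R x) = 1"
    by (simp add: vec_pnorm_scaleR[OF assms] flip: c_def)
  then have "vec_pnorm p (A *v (inverse c *\<^sub>R x)) \<le> operator_pnorm p A"
    unfolding operator_pnorm_def by (intro cSUP_upper bdd_above_operator_pnorm assms) simp
  with \<open>c > 0\<close> show ?thesis
    by (simp add: matrix_vector_mult_scaleR vec_pnorm_scaleR[OF assms] field_simps flip: c_def)
qed

lemma operator_pnorm_leI:
  assumes "1 \<le> p" "\<And>x. vec_pnorm p x = 1 \<Longrightarrow> vec_pnorm p (A *v x) \<le> c"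
  shows "operator_pnorm p A \<le> c"
  unfolding operator_pnorm_def
proof (rule cSUP_least)
  \<comment> \<open>Bounding a real \<open>SUP\<close> from above requires a nonempty index set; a
    normalised basis vector, at an arbitrary index, is a point of the unit sphere.\<close>
  define e :: "real^'a" where "e = axis undefined 1"
  have "e \<noteq> 0" by (simp add: e_def)
  then have "vec_pnorm p (inverse (vec_pnorm p e) *\<^sub>R e) = 1"
    by (simp add: vec_pnorm_scaleR vec_pnorm_nonneg vec_pnorm_eq_0_iff assms(1))
  then show "{x :: real^'a. vec_pnorm p x = 1} \<noteq> {}" by blast
qed (use assms(2) in simp)

text \<open>For a vector \<open>e\<close> of positive norm, the product of the operator norm and the
  norm of \<open>e\<close> dominates the norm of \<open>A *v e\<close>, which is
  nonnegative.\<close>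

lemma operator_pnorm_nonneg:
  assumes "1 \<le> p"
  shows "0 \<le> operator_pnorm p A"
proof -
  define e :: "real^'a" where "e = axis undefined 1"
  have "vec_pnorm p e > 0"
    using vec_pnorm_nonneg[OF assms, of e] vec_pnorm_eq_0_iff[OF assms, of e]
    by (simp add: e_def less_le)
  moreover have "0 \<le> operator_pnorm p A * vec_pnorm p e"
    using vec_pnorm_le_operator_pnorm[OF assms] vec_pnorm_nonneg[OF assms] order_trans by blast
  ultimately show ?thesis by (simp add: zero_le_mult_iff)
qed

lemma stochastic_seminorm_operator_pnorm:
  assumes "1 \<le> p"
  shows "stochastic_seminorm (operator_pnorm p)"
proof
  fix A B W :: "real^'n^'n" and c :: real
  note bound = vec_pnorm_le_operator_pnorm[OF assms]
  show "operator_pnorm p (A + B) \<le> operator_pnorm p A + operator_pnorm p B"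
  proof (rule operator_pnorm_leI[OF assms])
    fix x :: "real^'n" assume "vec_pnorm p x = 1"
    then show "vec_pnorm p ((A + B) *v x) \<le> operator_pnorm p A + operator_pnorm p B"
      using vec_pnorm_add_le[OF assms, of "A *v x" "B *v x"] bound[of A x] bound[of B x]
      by (simp add: matrix_vector_mult_add_rdistrib)
  qed
  show "operator_pnorm p (c *\<^sub>R A) \<le> \<bar>c\<bar> * operator_pnorm p A"
  proof (rule operator_pnorm_leI[OF assms])
    fix x :: "real^'n" assume "vec_pnorm p x = 1"
    then show "vec_pnorm p (c *\<^sub>R A *v x) \<le> \<bar>c\<bar> * operator_pnorm p A"
      using bound[of A x]
      by (simp add: vec_pnorm_scaleR[OF assms] mult_left_mono flip: scaleR_matrix_vector_assoc)
  qed
  assume W: "W \<in> doubly_stochastic"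
  show "operator_pnorm p (W ** A) \<le> operator_pnorm p A"
  proof (rule operator_pnorm_leI[OF assms])
    fix x :: "real^'n" assume "vec_pnorm p x = 1"
    then show "vec_pnorm p (W ** A *v x) \<le> operator_pnorm p A"
      using bound[of A x] vec_pnorm_doubly_stochastic_le[OF assms W, of "A *v x"]
      by (simp add: matrix_vector_mul_assoc)
  qed
  show "operator_pnorm p (A ** W) \<le> operator_pnorm p A"
  proof (rule operator_pnorm_leI[OF assms])
    fix x :: "real^'n" assume x: "vec_pnorm p x = 1"
    \<comment> \<open>\<open>W *v x\<close> need not be a unit vector, so the homogeneous bound is
      used; its norm is at most 1 by contraction.\<close>
    have "vec_pnorm p (A ** W *v x) \<le> operator_pnorm p A * vec_pnorm p (W *v x)"
      using bound[of A "W *v x"] by (simp add: matrix_vector_mul_assoc)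
    also have "\<dots> \<le> operator_pnorm p A * 1"
      using vec_pnorm_doubly_stochastic_le[OF assms W, of x] x
      by (intro mult_left_mono operator_pnorm_nonneg assms) simp
    finally show "vec_pnorm p (A ** W *v x) \<le> operator_pnorm p A" by simp
  qed
qed

section \<open>The pseudometric\<close>

text \<open>The trace is the transport cost of the plan \<open>W\<close>; as an explicit double sum
  it is visibly linear in \<open>W\<close>.\<close>

lemma trace_transpose_cross_dist:
  "trace (transpose W ** cross_dist d f g) = (\<Sum>u\<in>UNIV. \<Sum>v\<in>UNIV. W $ u $ v * d (f u) (g v))"
  unfolding trace_def matrix_matrix_mult_def transpose_def cross_dist_def
  by (simp, rule sum.swap)

text \<open>Gluing of transport plans: \<open>V $ u $ k * W $ k $ v\<close> is the mass sent from
  \<open>u\<close> to \<open>v\<close> through \<open>k\<close>. The triangle inequality for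
  \<open>d\<close> is weighted with it, and the marginals recover the two costs.\<close>

lemma trace_cross_dist_triangle:
  assumes d: "Metric_space \<Omega> d"
    and fgh: "f \<in> embeddings \<Omega>" "g \<in> embeddings \<Omega>" "h \<in> embeddings \<Omega>"
    and V: "V \<in> doubly_stochastic" and W: "W \<in> doubly_stochastic"
  shows "trace (transpose (V ** W) ** cross_dist d f h)
    \<le> trace (transpose V ** cross_dist d f g) + trace (transpose W ** cross_dist d g h)"
proof -
  note VD = doubly_stochasticD[OF V] and WD = doubly_stochasticD[OF W]
  have "trace (transpose (V ** W) ** cross_dist d f h)
      = (\<Sum>u\<in>UNIV. \<Sum>v\<in>UNIV. \<Sum>k\<in>UNIV. V $ u $ k * W $ k $ v * d (f u) (h v))"
    unfolding trace_transpose_cross_dist by (simp add: matrix_matrix_mult_def sum_distrib_right)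
  also have "\<dots> \<le> (\<Sum>u\<in>UNIV. \<Sum>v\<in>UNIV. \<Sum>k\<in>UNIV.
      V $ u $ k * W $ k $ v * (d (f u) (g k) + d (g k) (h v)))"
    using fgh by (intro sum_mono mult_left_mono Metric_space.triangle[OF d] mult_nonneg_nonneg VD WD)
      (auto simp: embeddings_def)
  also have "\<dots> = (\<Sum>u\<in>UNIV. \<Sum>v\<in>UNIV. \<Sum>k\<in>UNIV. W $ k $ v * (V $ u $ k * d (f u) (g k)))
      + (\<Sum>u\<in>UNIV. \<Sum>v\<in>UNIV. \<Sum>k\<in>UNIV. V $ u $ k * (W $ k $ v * d (g k) (h v)))"
    by (simp add: algebra_simps sum.distrib)
  \<comment> \<open>With \<open>v\<close> summed innermost, the row sums of \<open>W\<close> are 1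
    and only the cost of \<open>V\<close> remains.\<close>
  also have "(\<Sum>u\<in>UNIV. \<Sum>v\<in>UNIV. \<Sum>k\<in>UNIV. W $ k $ v * (V $ u $ k * d (f u) (g k)))
      = (\<Sum>u\<in>UNIV. \<Sum>k\<in>UNIV. \<Sum>v\<in>UNIV. W $ k $ v * (V $ u $ k * d (f u) (g k)))"
    by (intro sum.cong refl sum.swap)
  also have "\<dots> = trace (transpose V ** cross_dist d f g)"
    by (simp add: trace_transpose_cross_dist WD flip: sum_distrib_right)
  \<comment> \<open>Likewise \<open>u\<close> goes innermost, where the column sums of
    \<open>V\<close> are 1.\<close>
  also have "(\<Sum>u\<in>UNIV. \<Sum>v\<in>UNIV. \<Sum>k\<in>UNIV. V $ u $ k * (W $ k $ v * d (g k) (h v)))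
      = (\<Sum>v\<in>UNIV. \<Sum>k\<in>UNIV. \<Sum>u\<in>UNIV. V $ u $ k * (W $ k $ v * d (g k) (h v)))"
    by (subst sum.swap) (intro sum.cong refl sum.swap)
  also have "\<dots> = (\<Sum>v\<in>UNIV. \<Sum>k\<in>UNIV. W $ k $ v * d (g k) (h v))"
    by (simp add: VD flip: sum_distrib_right)
  also have "\<dots> = trace (transpose W ** cross_dist d g h)"
    unfolding trace_transpose_cross_dist by (rule sum.swap)
  finally show ?thesis .
qed

section \<open>Attainment of the minimum and the pseudometric axioms\<close>

context stochastic_seminorm
begin

lemma zero: "N 0 = 0"
  using scaleR_le[of 0 0] add_le[of 0 0] by simp

lemma minus: "N (- A) = N A"
  using scaleR_le[of "-1" A] scaleR_le[of "-1" "- A"] by simp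

lemma nonneg: "0 \<le> N A"
  using add_le[of A "- A"] by (simp add: zero minus)

text \<open>Subadditivity and scaling make \<open>N\<close> convex, and a convex function on a
  finite-dimensional space is continuous.\<close>

lemma continuous_on_seminorm: "continuous_on S N"
proof -
  have "convex_on UNIV N"
  proof (rule convex_onI)
    fix t :: real and A B :: "real^'n^'n" assume "0 < t" "t < 1"
    then show "N ((1 - t) *\<^sub>R A + t *\<^sub>R B) \<le> (1 - t) * N A + t * N B"
      using add_le[of "(1 - t) *\<^sub>R A" "t *\<^sub>R B"] scaleR_le[of "1 - t" A] scaleR_le[of t B] by simp
  qed simp
  then have "continuous_on UNIV N" by (rule convex_on_continuous[OF open_UNIV])
  then show ?thesis by (rule continuous_on_subset) simp
qed

text \<open>A continuous objective on a nonempty compact set attains its infimum, which is what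
  gives the \<open>LEAST\<close> in \<open>dist_W\<close> its meaning.\<close>

lemma dist_W_attained:
  obtains W where "W \<in> doubly_stochastic"
    and "dist_W N d (A, f) (B, g) = N (A ** W - W ** B) + trace (transpose W ** cross_dist d f g)"
    and "\<And>V. V \<in> doubly_stochastic \<Longrightarrow>
      dist_W N d (A, f) (B, g) \<le> N (A ** V - V ** B) + trace (transpose V ** cross_dist d f g)"
proof -
  let ?F = "\<lambda>W. N (A ** W - W ** B) + trace (transpose W ** cross_dist d f g)"
  have "continuous_on doubly_stochastic ?F"
    unfolding trace_transpose_cross_dist unfolding matrix_matrix_mult_def
    by (intro continuous_intros continuous_on_compose2[OF continuous_on_seminorm[of UNIV]]) simp_all
  moreover have "doubly_stochastic \<noteq> ({} :: (real^'n^'n) set)"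
    using doubly_stochastic_mat_1 by blast
  ultimately obtain W where W: "W \<in> doubly_stochastic" "\<And>V. V \<in> doubly_stochastic \<Longrightarrow> ?F W \<le> ?F V"
    using continuous_attains_inf[OF compact_doubly_stochastic] by blast
  then have "dist_W N d (A, f) (B, g) = ?F W"
    unfolding dist_W_def by (auto intro!: Least_equality)
  with W show thesis by (intro that) auto
qed

lemma dist_W_le:
  "V \<in> doubly_stochastic \<Longrightarrow>
    dist_W N d (A, f) (B, g) \<le> N (A ** V - V ** B) + trace (transpose V ** cross_dist d f g)"
  using dist_W_attained[of d A f B g] by blast

lemma dist_W_nonneg:
  assumes "Metric_space \<Omega> d"
  shows "0 \<le> dist_W N d x y"
proof -
  obtain A f B g where "x = (A, f)" "y = (B, g)" by fastforce
  moreover obtain W where "W \<in> doubly_stochastic"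
    "dist_W N d (A, f) (B, g) = N (A ** W - W ** B) + trace (transpose W ** cross_dist d f g)"
    using dist_W_attained .
  ultimately show ?thesis
    by (simp add: nonneg trace_transpose_cross_dist sum_nonneg doubly_stochasticD
        Metric_space.nonneg[OF assms])
qed

text \<open>The identity matrix has cost 0: it commutes with \<open>A\<close>, and the trace then
  sees only the distances from \<open>f u\<close> to itself.\<close>

lemma dist_W_refl:
  assumes "Metric_space \<Omega> d" and "x \<in> UNIV \<times> embeddings \<Omega>"
  shows "dist_W N d x x = 0"
proof -
  obtain A f where x: "x = (A, f)" by fastforce
  with assms(2) have "f u \<in> \<Omega>" for u by (auto simp: embeddings_def)
  then have "trace (transpose (mat 1) ** cross_dist d f f) = 0"
    using Metric_space.mdist_zero[OF assms(1)]
    by (simp add: trace_def cross_dist_def)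
  then have "dist_W N d x x \<le> 0"
    using dist_W_le[OF doubly_stochastic_mat_1, of d A f A f] by (simp add: x zero)
  with dist_W_nonneg[OF assms(1), of x x] show ?thesis by simp
qed

lemma dist_W_triangle:
  assumes d: "Metric_space \<Omega> d"
    and "x \<in> UNIV \<times> embeddings \<Omega>" "y \<in> UNIV \<times> embeddings \<Omega>" "z \<in> UNIV \<times> embeddings \<Omega>"
  shows "dist_W N d x y \<le> dist_W N d x z + dist_W N d z y"
proof -
  obtain A f B g C h where xyz: "x = (A, f)" "y = (B, g)" "z = (C, h)" by (metis surj_pair)
  obtain V where V: "V \<in> doubly_stochastic"
    "dist_W N d x z = N (A ** V - V ** C) + trace (transpose V ** cross_dist d f h)"
    unfolding xyz using dist_W_attained .
  obtain W where W: "W \<in> doubly_stochastic"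
    "dist_W N d z y = N (C ** W - W ** B) + trace (transpose W ** cross_dist d h g)"
    unfolding xyz using dist_W_attained .
  \<comment> \<open>The terms \<open>V ** C ** W\<close> cancel. The right contraction will remove
    \<open>W\<close> from the first summand, the left contraction \<open>V\<close> from the
    second.\<close>
  have "A ** (V ** W) - (V ** W) ** B = (A ** V - V ** C) ** W + V ** (C ** W - W ** B)"
  proof -
    have "(A ** V - V ** C) ** W = A ** V ** W - V ** C ** W"
      "V ** (C ** W - W ** B) = V ** (C ** W) - V ** (W ** B)"
      by (simp_all add: vec_eq_iff matrix_matrix_mult_def algebra_simps sum_subtractf)
    then show ?thesis by (simp add: matrix_mul_assoc)
  qed
  then have "N (A ** (V ** W) - (V ** W) ** B) \<le> N (A ** V - V ** C) + N (C ** W - W ** B)"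
    using add_le[of "(A ** V - V ** C) ** W" "V ** (C ** W - W ** B)"]
      right_contraction[OF W(1), of "A ** V - V ** C"] left_contraction[OF V(1), of "C ** W - W ** B"]
    by simp
  moreover have "trace (transpose (V ** W) ** cross_dist d f g)
    \<le> trace (transpose V ** cross_dist d f h) + trace (transpose W ** cross_dist d h g)"
    using assms(2-4) V(1) W(1) by (intro trace_cross_dist_triangle[OF d]) (auto simp: xyz)
  ultimately show ?thesis
    using dist_W_le[OF doubly_stochastic_mult[OF V(1) W(1)], of d A f B g] V(2) W(2)
    by (simp add: xyz)
qed

text \<open>Symmetry holds by construction; the triangle inequality is the sum of those for
  \<open>dist_W\<close> from \<open>x\<close> to \<open>y\<close> and from \<open>y\<close> to
  \<open>x\<close>.\<close>

lemma pseudometric_on_symmetric_ext: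
  assumes "Metric_space \<Omega> d"
  shows "pseudometric_on (UNIV \<times> embeddings \<Omega>) (symmetric_ext (dist_W N d))"
  unfolding pseudometric_on_def symmetric_ext_def
proof (intro conjI ballI)
  fix x y z :: "(real^'n^'n) \<times> ('n \<Rightarrow> 'a)"
  assume xyz: "x \<in> UNIV \<times> embeddings \<Omega>" "y \<in> UNIV \<times> embeddings \<Omega>" "z \<in> UNIV \<times> embeddings \<Omega>"
  show "dist_W N d x y + dist_W N d y x
    \<le> dist_W N d x z + dist_W N d z x + (dist_W N d z y + dist_W N d y z)"
    using dist_W_triangle[OF assms xyz] dist_W_triangle[OF assms xyz(2,1,3)] by simp
qed (simp_all add: dist_W_nonneg[OF assms] dist_W_refl[OF assms])

lemma pseudometric_on_symmetric_matrices:
  assumes "Metric_space \<Omega> d" and transpose: "\<And>A. N (transpose A) = N A"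
  shows "pseudometric_on (symmetric_matrices \<times> embeddings \<Omega>) (dist_W N d)"
proof -
  \<comment> \<open>One inequality suffices: exchanging \<open>x\<close> and \<open>y\<close> gives
    the other. The transpose of an optimal plan for \<open>y\<close> and \<open>x\<close> is the
    competitor.\<close>
  have le: "dist_W N d x y \<le> dist_W N d y x"
    if xy: "x \<in> symmetric_matrices \<times> embeddings \<Omega>" "y \<in> symmetric_matrices \<times> embeddings \<Omega>" for x y
  proof -
    obtain A f B g where xy': "x = (A, f)" "y = (B, g)" by fastforce
    with xy have AB: "transpose A = A" "transpose B = B" by (auto simp: symmetric_matrices_def)
    obtain W where W: "W \<in> doubly_stochastic"
      "dist_W N d y x = N (B ** W - W ** A) + trace (transpose W ** cross_dist d g f)"
      unfolding xy' using dist_W_attained .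
    have "A ** transpose W - transpose W ** B = - transpose (B ** W - W ** A)"
    proof -
      have "transpose (B ** W - W ** A) = transpose (B ** W) - transpose (W ** A)"
        by (simp add: transpose_def vec_eq_iff)
      then show ?thesis by (simp add: matrix_transpose_mul AB)
    qed
    \<comment> \<open>The sign disappears because \<open>N\<close> is even, the transposition by the
      invariance hypothesis.\<close>
    then have "N (A ** transpose W - transpose W ** B) = N (B ** W - W ** A)"
      by (simp add: minus transpose)
    moreover have "trace (transpose (transpose W) ** cross_dist d f g) = trace (transpose W ** cross_dist d g f)"
      unfolding trace_transpose_cross_dist
      by (subst sum.swap) (simp add: transpose_def Metric_space.commute[OF assms(1)])
    ultimately show ?thesis
      using dist_W_le[OF doubly_stochastic_transpose[OF W(1)], of d A f B g] W(2) by (simp add: xy')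
  qed
  show ?thesis
    unfolding pseudometric_on_def
    by (auto simp: dist_W_nonneg[OF assms(1)] intro!: dist_W_refl[OF assms(1)] antisym le
        dist_W_triangle[OF assms(1)])
qed

end

theorem theorem5:
  fixes \<Omega> :: "'a set" and d :: "'a \<Rightarrow> 'a \<Rightarrow> real" and p :: enat
  assumes "Metric_space \<Omega> d" and "1 \<le> p"
  shows "pseudometric_on
           ((symmetric_matrices :: (real^'n^'n) set) \<times> embeddings \<Omega>)
           (dist_W (entrywise_pnorm p) d)
       \<and> pseudometric_on
           ((UNIV :: (real^'n^'n) set) \<times> embeddings \<Omega>)
           (symmetric_ext (dist_W (entrywise_pnorm p) d))
       \<and> pseudometric_on
           ((UNIV :: (real^'n^'n) set) \<times> embeddings \<Omega>)
           (symmetric_ext (dist_W (operator_pnorm p) d))"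
  using assms
  by (intro conjI stochastic_seminorm.pseudometric_on_symmetric_matrices
      stochastic_seminorm.pseudometric_on_symmetric_ext stochastic_seminorm_entrywise_pnorm
      stochastic_seminorm_operator_pnorm entrywise_pnorm_transpose)

end
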